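(* Let $m,n$ be positive integers with $m<n$, let $A=\operatorname{diag}(a_1,\ldots,a_{n-m},0,\ldots,0)\in\mathbb{R}^{n\times n}$ with $a_k>0$ for $k=1,\ldots,n-m$, and let $B\in\mathbb{S}^n$ be partitioned as $$B=\begin{pmatrix}B_{11}&B_{21}^T\\ B_{21}&B_{22}\end{pmatrix},\qquad B_{11}\in\mathbb{S}^{n-m},\ B_{21}\in\mathbb{R}^{m\times(n-m)},\ B_{22}\in\mathbb{S}^m.$$ Let $E=\{A+tB:t\in\mathbb{R}\}$ be a line and suppose $\mathbb{S}^n_+\cap E=\{A\}$. Let $U_0\in E$ and $U_{k+1}=P_E(P_{\mathbb{S}^n_+}(U_k))$ for $k=0,1,2,\ldots$. Then $\|U_k-A\|=O(k^{-1/2})$ as $k\to\infty$. Moreover, if $\operatorname{rank}\begin{pmatrix}B_{21}&B_{22}\end{pmatrix}=\operatorname{rank}B_{22}$, then $\|U_k-A\|$ converges to $0$ at a linear rate.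
   Context: $\mathbb{S}^n$ is the space of real symmetric $n\times n$ matrices with inner product $\langle U,V\rangle=\operatorname{tr}(UV)$ and Frobenius norm $\|U\|=\sqrt{\langle U,U\rangle}$; $\mathbb{S}^n_+$ is the cone of positive semidefinite matrices in $\mathbb{S}^n$. For a closed convex set $H\subset\mathbb{S}^n$, $P_H(U)=\operatorname{argmin}_{X\in H}\|X-U\|$ is the projection onto $H$. That $E$ is a line means $B\neq O$. Convergence to $0$ at a linear rate means that there are constants $c>0$ and $q\in(0,1)$ such that $\|U_k-A\|\le c\,q^k$ for all $k$. *)

theory Defs
  imports "HOL-Analysis.Analysis" "HOL-Library.Landau_Symbols"
begin

(* Dimensions are types.  With CARD('q) = m and CARD('p) = n - m, the index type 'p + 'q has n
   elements, Inl being the first n - m indices and Inr the last m; since 'p and 'q are nonempty,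
   this is exactly 0 < m < n. *)

definition sym_mats :: "(real ^ 'n ^ 'n) set" where
  "sym_mats = {U. transpose U = U}"

definition psd_cone :: "(real ^ 'n ^ 'n) set" where
  "psd_cone = {U \<in> sym_mats. \<forall>x. 0 \<le> x \<bullet> (U *v x)}"

definition diag_matrix :: "real ^ 'n \<Rightarrow> real ^ 'n ^ 'n" where
  "diag_matrix d = (\<chi> i j. if i = j then d $ i else 0)"

definition vcat :: "'a ^ 'p \<Rightarrow> 'a ^ 'q \<Rightarrow> 'a ^ ('p + 'q)" where
  "vcat x y = (\<chi> i. case i of Inl k \<Rightarrow> x $ k | Inr l \<Rightarrow> y $ l)"

(* The row-partitioned matrix (M N). *)
definition hblock :: "'a ^ 'p ^ 'r \<Rightarrow> 'a ^ 'q ^ 'r \<Rightarrow> 'a ^ ('p + 'q) ^ 'r" where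
  "hblock M N = (\<chi> i. vcat (M $ i) (N $ i))"

definition block_matrix ::
  "'a ^ 'p ^ 'p \<Rightarrow> 'a ^ 'q ^ 'p \<Rightarrow> 'a ^ 'p ^ 'q \<Rightarrow> 'a ^ 'q ^ 'q \<Rightarrow> 'a ^ ('p + 'q) ^ ('p + 'q)" where
  "block_matrix M11 M12 M21 M22 = vcat (hblock M11 M12) (hblock M21 M22)"

definition matrix_line :: "real ^ 'n ^ 'n \<Rightarrow> real ^ 'n ^ 'n \<Rightarrow> (real ^ 'n ^ 'n) set" where
  "matrix_line A B = {A + t *\<^sub>R B | t. True}"

(* On symmetric matrices the library's inner product and norm on real ^ 'n ^ 'n are the trace
   inner product and the Frobenius norm, so that closest_point H is the projection P_H. *)

lemma inner_eq_trace:
  fixes U V :: "real ^ 'n ^ 'n"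
  assumes "V \<in> sym_mats"
  shows "U \<bullet> V = trace (U ** V)"
proof -
  have "V $ i $ j = V $ j $ i" for i j
    using assms unfolding sym_mats_def transpose_def by (metis (mono_tags, lifting) mem_Collect_eq vec_lambda_beta)
  then show ?thesis
    by (simp add: inner_vec_def trace_def matrix_matrix_mult_def)
qed

lemma norm_eq_frobenius:
  fixes U :: "real ^ 'n ^ 'n"
  assumes "U \<in> sym_mats"
  shows "norm U = sqrt (trace (U ** U))"
  using inner_eq_trace[OF assms] by (simp add: norm_eq_sqrt_inner)

end

theory Submission
  imports Defs
begin

text \<open>
  Both rates come from a lower bound on the distance from a point of the line to the cone.
  Projections onto closed convex sets are firmly nonexpansive, so one round of alternating
  projections from \<open>x\<close> lowers the squared distance to the common point \<open>A\<close> by at least the squared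
  distance from \<open>x\<close> to the cone (\<open>alternating_projection_decrease\<close>).  If that distance is at least
  a multiple of \<open>(dist x A)\<^sup>2\<close>, then \<open>r\<^sub>k = (dist (x k) A)\<^sup>2\<close> satisfies \<open>r\<^sub>k\<^sub>+\<^sub>1 \<le> r\<^sub>k - c r\<^sub>k\<^sup>2\<close>, whence
  \<open>r\<^sub>k = O(1/k)\<close>; if it is at least a multiple of \<open>dist x A\<close>, the decay is geometric.

  The distance from a symmetric matrix \<open>M\<close> to the cone is bounded below by \<open>- x \<bullet> (M *v x)\<close> for a unit
  vector \<open>x\<close> (\<open>psd_distance_lower_bound\<close>), so it suffices to exhibit good test vectors for
  \<open>A + t B\<close>.  Fix the sign \<open>t > 0\<close>; the other sign follows by replacing \<open>B\<close> with \<open>- B\<close>.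
  If \<open>y \<bullet> (B22 *v y) < 0\<close>, the vector \<open>(0, y)\<close> gives a distance of order \<open>t\<close>.
  If \<open>B22\<close> is positive semidefinite and some \<open>v\<close> in its kernel has \<open>w = transpose B21 *v v \<noteq> 0\<close>,
  then \<open>(- \<epsilon> t w, v)\<close> gives a distance of order \<open>t\<^sup>2\<close>: the mixed term is negative of order
  \<open>\<epsilon> t\<^sup>2\<close>, all the others are of order \<open>\<epsilon>\<^sup>2 t\<^sup>2\<close>.
  In the remaining case \<open>B21 = B22 ** K\<close> for some \<open>K\<close>; completing the square then shows that
  \<open>A + t B\<close> is positive semidefinite for small \<open>t > 0\<close>, contradicting that the line meets the cone
  only in \<open>A\<close> (\<open>ray_leaves_psd_cone_cases\<close>).  The rank condition says precisely that the kernel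
  of \<open>B22\<close> is contained in that of \<open>transpose B21\<close>, so that under it only the first case occurs,
  for both signs of \<open>t\<close>.
\<close>

section \<open>Recursive inequalities\<close>

text \<open>The inequality is the discrete form of \<open>y' = - y\<^sup>2\<close>: since \<open>1 - y \<le> 1 / (1 + y)\<close>, the
  reciprocal of \<open>y\<close> grows by at least 1 in each step.\<close>

lemma inverse_linear_decay:
  fixes y :: "nat \<Rightarrow> real"
  assumes nonneg: "\<And>k. 0 \<le> y k" and step: "\<And>k. y (Suc k) \<le> y k - (y k)\<^sup>2"
  shows "y k \<le> 1 / (real k + 1)"
proof (induction k)
  case 0
  have "\<not> 1 < y 0"
    using nonneg[of "Suc 0"] step[of 0] mult_strict_right_mono[of 1 "y 0" "y 0"]
    unfolding power2_eq_square by linarith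
  then show ?case by simp
next
  case (Suc k)
  define z where "z = y k"
  have z: "0 \<le> z" "z \<le> 1 / (real k + 1)"
    using nonneg Suc by (auto simp: z_def)
  have z': "z * (real k + 1) \<le> 1"
    using mult_right_mono[OF z(2), of "real k + 1"] by simp
  have "z - z\<^sup>2 \<le> z / (1 + z)"
  proof -
    have "(z - z\<^sup>2) * (1 + z) = z - z ^ 3"
      by algebra
    also have "\<dots> \<le> z"
      using z(1) by simp
    finally show ?thesis
      using z(1) by (subst pos_le_divide_eq) auto
  qed
  also have "\<dots> \<le> 1 / (real (Suc k) + 1)"
  proof -
    have "z * (real (Suc k) + 1) \<le> 1 * (1 + z)"
      using z' unfolding of_nat_Suc distrib_left by simp
    then show ?thesis
      using z(1) by (simp add: pos_divide_le_eq pos_le_divide_eq mult.commute)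
  qed
  finally show ?case
    using step[of k] by (simp add: z_def)
qed

section \<open>Alternating projections under an error bound\<close>

text \<open>By convexity, the angle at the projection between the directions to \<open>x\<close> and to \<open>a\<close> is at
  least a right angle.\<close>

lemma closest_point_pythagoras:
  fixes S :: "'a::euclidean_space set"
  assumes "convex S" "closed S" "a \<in> S"
  shows "(dist (closest_point S x) a)\<^sup>2 + (dist x (closest_point S x))\<^sup>2 \<le> (dist x a)\<^sup>2"
proof -
  let ?p = "closest_point S x"
  have "(x - ?p) \<bullet> (a - ?p) \<le> 0"
    using closest_point_dot[OF assms] .
  moreover have "(norm (x - a))\<^sup>2 = (norm (?p - a))\<^sup>2 + (norm (x - ?p))\<^sup>2 - 2 * ((x - ?p) \<bullet> (a - ?p))"
    by (simp add: power2_norm_eq_inner inner_diff_left inner_diff_right inner_commute algebra_simps)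
  ultimately show ?thesis
    by (simp add: dist_norm)
qed

lemma alternating_projection_decrease:
  fixes S E :: "'a::euclidean_space set"
  assumes "convex S" "closed S" "convex E" "closed E" "a \<in> S" "a \<in> E"
  shows "(dist (closest_point E (closest_point S x)) a)\<^sup>2 + (dist x (closest_point S x))\<^sup>2
           \<le> (dist x a)\<^sup>2"
  using closest_point_pythagoras[OF assms(1,2,5), of x]
    closest_point_pythagoras[OF assms(3,4,6), of "closest_point S x"]
    zero_le_power2[of "dist (closest_point S x) (closest_point E (closest_point S x))"]
  by linarith

text \<open>The iterates stay in \<open>E\<close> and never move away from \<open>a\<close>; an error bound on the part of \<open>E\<close>
  no farther from \<open>a\<close> than the starting point therefore applies to all of them.\<close>

lemma alternating_projections_invariant:
  fixes S E :: "'a::euclidean_space set"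
  assumes "convex S" "closed S" "convex E" "closed E" "a \<in> S" "a \<in> E"
    and "x 0 \<in> E" and step: "\<And>k. x (Suc k) = closest_point E (closest_point S (x k))"
  shows "x k \<in> E \<and> dist (x k) a \<le> dist (x 0) a"
proof (induction k)
  case 0
  then show ?case using assms by simp
next
  case (Suc k)
  have "(dist (x (Suc k)) a)\<^sup>2 \<le> (dist (x k) a)\<^sup>2"
    using alternating_projection_decrease[OF assms(1-6), of "x k"]
      zero_le_power2[of "dist (x k) (closest_point S (x k))"] unfolding step by linarith
  then have "dist (x (Suc k)) a \<le> dist (x k) a"
    by (rule power2_le_imp_le) simp
  moreover have "x (Suc k) \<in> E"
    using closest_point_in_set[of E] assms(4,6) by (auto simp: step)
  ultimately show ?case using Suc by simp
qed

lemma alternating_projections_quadratic_bound: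
  fixes S E :: "'a::euclidean_space set"
  assumes sets: "convex S" "closed S" "convex E" "closed E" "a \<in> S" "a \<in> E"
    and start: "x 0 \<in> E" and step: "\<And>k. x (Suc k) = closest_point E (closest_point S (x k))"
    and "0 < \<kappa>"
    and bound: "\<And>u p. u \<in> E \<Longrightarrow> dist u a \<le> dist (x 0) a \<Longrightarrow> p \<in> S \<Longrightarrow> \<kappa> * (dist u a)\<^sup>2 \<le> dist u p"
  shows "(\<lambda>k. dist (x k) a) \<in> O(\<lambda>k. real k powr (- 1 / 2))"
proof -
  define y where "y k = \<kappa>\<^sup>2 * (dist (x k) a)\<^sup>2" for k
  have "y (Suc k) \<le> y k - (y k)\<^sup>2" for k
  proof -
    let ?p = "closest_point S (x k)"
    have "?p \<in> S" using closest_point_in_set[of S] sets by auto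
    then have "\<kappa> * (dist (x k) a)\<^sup>2 \<le> dist (x k) ?p"
      using bound alternating_projections_invariant[OF sets start step] by blast
    then have "(\<kappa> * (dist (x k) a)\<^sup>2)\<^sup>2 \<le> (dist (x k) ?p)\<^sup>2"
      using \<open>0 < \<kappa>\<close> by (intro power_mono) auto
    then have "(dist (x (Suc k)) a)\<^sup>2 \<le> (dist (x k) a)\<^sup>2 - (\<kappa> * (dist (x k) a)\<^sup>2)\<^sup>2"
      using alternating_projection_decrease[OF sets, of "x k"] by (simp add: step)
    then have "\<kappa>\<^sup>2 * (dist (x (Suc k)) a)\<^sup>2 \<le> \<kappa>\<^sup>2 * ((dist (x k) a)\<^sup>2 - (\<kappa> * (dist (x k) a)\<^sup>2)\<^sup>2)"
      by (rule mult_left_mono) simp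
    then show ?thesis
      by (simp add: y_def algebra_simps power2_eq_square)
  qed
  then have y: "y k \<le> 1 / (real k + 1)" for k
    by (intro inverse_linear_decay) (auto simp: y_def)
  have "dist (x k) a \<le> (1 / \<kappa>) * real k powr (- 1 / 2)" if "1 \<le> k" for k
  proof -
    have "(\<kappa> * dist (x k) a)\<^sup>2 \<le> 1 / real k"
      using order_trans[OF y[of k], of "1 / real k"] that
      by (simp add: y_def power_mult_distrib frac_le)
    then have "\<kappa> * dist (x k) a \<le> sqrt (1 / real k)"
      by (rule real_le_rsqrt)
    also have "\<dots> = real k powr (- 1 / 2)"
      using that powr_minus[of "real k" "1 / 2"]
      by (simp add: powr_half_sqrt real_sqrt_divide inverse_eq_divide)
    finally show ?thesis
      using \<open>0 < \<kappa>\<close> by (simp add: field_simps)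
  qed
  then show ?thesis
    by (intro bigoI[of _ "1 / \<kappa>"] eventually_sequentiallyI[of 1]) auto
qed

lemma alternating_projections_linear_bound:
  fixes S E :: "'a::euclidean_space set"
  assumes sets: "convex S" "closed S" "convex E" "closed E" "a \<in> S" "a \<in> E"
    and start: "x 0 \<in> E" and step: "\<And>k. x (Suc k) = closest_point E (closest_point S (x k))"
    and "0 < \<kappa>"
    and bound: "\<And>u p. u \<in> E \<Longrightarrow> p \<in> S \<Longrightarrow> \<kappa> * dist u a \<le> dist u p"
  shows "\<exists>c q. 0 < c \<and> 0 < q \<and> q < 1 \<and> (\<forall>k. dist (x k) a \<le> c * q ^ k)"
proof -
  \<comment> \<open>Any constant below \<open>\<kappa>\<close> serves as well; keeping it below 1 makes the ratio \<open>q\<close> positive.\<close>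
  define l where "l = min \<kappa> (1 / 2)"
  have l: "0 < l" "l < 1" "l \<le> \<kappa>" using \<open>0 < \<kappa>\<close> by (auto simp: l_def)
  have l2: "0 < l\<^sup>2" "l\<^sup>2 < 1"
    using l by (auto simp: power_less_one_iff)
  define q where "q = sqrt (1 - l\<^sup>2)"
  have q: "0 < q" "q < 1" "q\<^sup>2 = 1 - l\<^sup>2" using l2 by (auto simp: q_def)
  have contract: "dist (x (Suc k)) a \<le> q * dist (x k) a" for k
  proof -
    let ?p = "closest_point S (x k)"
    have "?p \<in> S" using closest_point_in_set[of S] sets by auto
    then have "\<kappa> * dist (x k) a \<le> dist (x k) ?p"
      using bound alternating_projections_invariant[OF sets start step] by blast
    then have "l * dist (x k) a \<le> dist (x k) ?p"
      using mult_right_mono[OF l(3) zero_le_dist[of "x k" a]] by linarith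
    then have "(l * dist (x k) a)\<^sup>2 \<le> (dist (x k) ?p)\<^sup>2"
      using l by (intro power_mono) auto
    then have "(dist (x (Suc k)) a)\<^sup>2 \<le> (q * dist (x k) a)\<^sup>2"
      using alternating_projection_decrease[OF sets, of "x k"]
      by (simp add: step power_mult_distrib q(3) algebra_simps)
    then show ?thesis
      by (rule power2_le_imp_le) (use q in simp)
  qed
  have "dist (x k) a \<le> (dist (x 0) a + 1) * q ^ k" for k
  proof (induction k)
    case (Suc k)
    show ?case
      using contract[of k] mult_left_mono[OF Suc, of q] q by (simp add: algebra_simps)
  qed simp
  then show ?thesis
    using q by (intro exI[of _ "dist (x 0) a + 1"] exI[of _ q]) (auto simp: add_nonneg_pos)
qed

section \<open>The positive semidefinite cone\<close>

lemma inner_transpose_mult: "u \<bullet> (transpose M *v v) = v \<bullet> (M *v u)"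
  for M :: "real ^ 'p ^ 'q"
  by (metis dot_lmul_matrix inner_commute transpose_matrix_vector)

text \<open>Cauchy--Schwarz, with the form read as the inner product of \<open>M\<close> with the rank-one matrix of
  \<open>x\<close>.\<close>

lemma abs_quadratic_form_le:
  fixes M :: "real ^ 'n ^ 'n"
  shows "\<bar>x \<bullet> (M *v x)\<bar> \<le> norm M * (norm x)\<^sup>2"
proof -
  define X :: "real ^ 'n ^ 'n" where "X = (\<chi> i j. x $ i * x $ j)"
  have "x \<bullet> (M *v x) = M \<bullet> X"
    by (simp add: X_def inner_vec_def matrix_vector_mult_def sum_distrib_left mult_ac)
  moreover have "norm X = (norm x)\<^sup>2"
  proof -
    have "X \<bullet> X = (x \<bullet> x) * (x \<bullet> x)"
      by (simp add: X_def inner_vec_def sum_distrib_left sum_distrib_right mult_ac)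
    then show ?thesis
      by (simp add: norm_eq_sqrt_inner)
  qed
  ultimately show ?thesis
    using Cauchy_Schwarz_ineq2[of M X] by simp
qed

lemma psd_distance_lower_bound:
  assumes "P \<in> psd_cone"
  shows "- (x \<bullet> (M *v x)) \<le> norm (P - M) * (norm x)\<^sup>2"
proof -
  have "0 \<le> x \<bullet> (P *v x)"
    using assms by (simp add: psd_cone_def)
  then have "- (x \<bullet> (M *v x)) \<le> x \<bullet> ((P - M) *v x)"
    by (simp add: matrix_vector_mult_diff_rdistrib inner_diff_right)
  then show ?thesis
    using abs_quadratic_form_le[of x "P - M"] by linarith
qed

lemma convex_psd_cone: "convex (psd_cone :: (real ^ 'n ^ 'n) set)"
proof (rule convexI)
  fix X Y :: "real ^ 'n ^ 'n" and s t :: real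
  assume "X \<in> psd_cone" "Y \<in> psd_cone" "0 \<le> s" "0 \<le> t" "s + t = 1"
  then show "s *\<^sub>R X + t *\<^sub>R Y \<in> psd_cone"
    by (auto simp: psd_cone_def sym_mats_def transpose_def vec_eq_iff matrix_vector_mult_add_rdistrib
        scaleR_matrix_vector_assoc[symmetric] inner_add_right)
qed

lemma closed_psd_cone: "closed (psd_cone :: (real ^ 'n ^ 'n) set)"
proof -
  have eq: "psd_cone = (\<Inter>i j. {U :: real ^ 'n ^ 'n. U $ j $ i = U $ i $ j})
                   \<inter> (\<Inter>x. {U. 0 \<le> x \<bullet> (U *v x)})"
    by (auto simp: psd_cone_def sym_mats_def transpose_def vec_eq_iff)
  have form: "closed {U :: real ^ 'n ^ 'n. 0 \<le> x \<bullet> (U *v x)}" for x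
    unfolding inner_vec_def matrix_vector_mult_def
    by (simp, intro closed_Collect_le continuous_intros)
  have sym: "closed {U :: real ^ 'n ^ 'n. U $ j $ i = U $ i $ j}" for i j
    by (intro closed_Collect_eq continuous_intros)
  show ?thesis
    unfolding eq by (intro closed_Int closed_INT ballI form sym)
qed

section \<open>Quadratic forms of block matrices\<close>

lemma vcat_nth [simp]: "vcat x y $ Inl k = x $ k" "vcat x y $ Inr l = y $ l"
  by (simp_all add: vcat_def)

lemma vcat_components: "x = vcat (\<chi> k. x $ Inl k) (\<chi> l. x $ Inr l)"
  by (simp add: vcat_def vec_eq_iff split: sum.split)

lemma sum_UNIV_sum_type: "(\<Sum>i\<in>UNIV. f i) = (\<Sum>k\<in>UNIV. f (Inl k)) + (\<Sum>l\<in>UNIV. f (Inr l))"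
  for f :: "'p::finite + 'q::finite \<Rightarrow> 'b::comm_monoid_add"
  using sum.Plus[of "UNIV :: 'p set" "UNIV :: 'q set" f] by simp

lemma inner_vcat: "vcat u v \<bullet> vcat u' v' = u \<bullet> u' + v \<bullet> v'"
  for u u' :: "real ^ 'p::finite" and v v' :: "real ^ 'q::finite"
  by (simp add: inner_vec_def sum_UNIV_sum_type)

lemma norm_vcat: "(norm (vcat u v))\<^sup>2 = (norm u)\<^sup>2 + (norm v)\<^sup>2"
  for u :: "real ^ 'p::finite" and v :: "real ^ 'q::finite"
  by (simp add: power2_norm_eq_inner inner_vcat)

lemma hblock_mult_vcat: "hblock M N *v vcat u v = M *v u + N *v v"
  for u :: "real ^ 'p::finite" and v :: "real ^ 'q::finite"
  by (simp add: hblock_def matrix_vector_mult_def vec_eq_iff sum_UNIV_sum_type)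

lemma block_matrix_mult_vcat:
  fixes u :: "real ^ 'p::finite" and v :: "real ^ 'q::finite"
  shows "block_matrix M11 M12 M21 M22 *v vcat u v = vcat (M11 *v u + M12 *v v) (M21 *v u + M22 *v v)"
proof -
  have "vcat P Q *v x = vcat (P *v x) (Q *v x)"
    for P :: "real ^ ('p + 'q) ^ 'p" and Q :: "real ^ ('p + 'q) ^ 'q" and x
    by (simp add: vcat_def matrix_vector_mult_def vec_eq_iff split: sum.split)
  then show ?thesis
    by (simp add: block_matrix_def hblock_mult_vcat)
qed

lemma diag_matrix_quadratic_form: "x \<bullet> (diag_matrix d *v x) = (\<Sum>i\<in>UNIV. d $ i * (x $ i)\<^sup>2)"
proof -
  have "(diag_matrix d *v x) $ i = d $ i * x $ i" for i
    by (simp add: diag_matrix_def matrix_vector_mult_def if_distrib[of "\<lambda>z. z * _"] cong: if_cong)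
  then show ?thesis
    by (simp add: inner_vec_def power2_eq_square mult_ac)
qed

lemma block_line_quadratic_form:
  fixes a :: "real ^ 'p::finite" and B21 :: "real ^ 'p ^ 'q::finite"
  shows "vcat u v \<bullet> ((diag_matrix (vcat a 0)
            + t *\<^sub>R block_matrix B11 (transpose B21) B21 B22) *v vcat u v)
       = u \<bullet> (diag_matrix a *v u)
            + t * (u \<bullet> (B11 *v u) + 2 * (v \<bullet> (B21 *v u)) + v \<bullet> (B22 *v v))"
  by (simp add: matrix_vector_mult_add_rdistrib inner_add_right scaleR_matrix_vector_assoc[symmetric]
      diag_matrix_quadratic_form sum_UNIV_sum_type block_matrix_mult_vcat inner_vcat
      inner_transpose_mult algebra_simps del: transpose_matrix_vector)

text \<open>Symmetry of \<open>N\<close> makes its range the orthogonal complement of its kernel; if that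
  kernel is orthogonal to the columns of \<open>M\<close>, these columns therefore lie in the range of \<open>N\<close>.\<close>

lemma factor_through_symmetric:
  fixes M :: "real ^ 'p::finite ^ 'q::finite" and N :: "real ^ 'q ^ 'q"
  assumes sym: "transpose N = N" and ker: "\<And>v. N *v v = 0 \<Longrightarrow> transpose M *v v = 0"
  obtains K where "M = N ** K"
proof -
  have "\<exists>w. M *v u = N *v w" for u
  proof -
    obtain s z where s: "s \<in> span (range ((*v) N))"
      and z: "\<And>w. w \<in> span (range ((*v) N)) \<Longrightarrow> orthogonal z w" and Mu: "M *v u = s + z"
      using orthogonal_subspace_decomp_exists[of "range ((*v) N)" "M *v u"] by blast
    have "w \<bullet> (N *v z) = 0" for w
      using z[of "N *v w"] inner_transpose_mult[of w N z]
      by (simp add: sym orthogonal_def span_base inner_commute)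
    then have "N *v z = 0"
      by (metis inner_eq_zero_iff)
    then have "u \<bullet> (transpose M *v z) = 0"
      by (simp add: ker del: transpose_matrix_vector)
    then have "z \<bullet> (s + z) = 0"
      by (simp add: inner_transpose_mult Mu del: transpose_matrix_vector)
    then have "z = 0"
      using z[OF s] by (simp add: orthogonal_def inner_add_right)
    moreover have "span (range ((*v) N)) = range ((*v) N)"
      by (simp only: span_eq_iff) (simp add: linear_subspace_image)
    ultimately show ?thesis
      using s Mu by (metis add.right_neutral rangeE)
  qed
  then obtain f where f: "\<And>u. M *v u = N *v f u" by metis
  define K :: "real ^ 'p ^ 'q" where "K = (\<chi> i j. f (axis j 1) $ i)"
  have "M $ i $ j = (N ** K) $ i $ j" for i j
  proof -
    have "M $ i $ j = (M *v axis j 1) $ i"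
      by (simp add: matrix_vector_mult_basis column_def)
    also have "\<dots> = (N ** K) $ i $ j"
      unfolding f by (simp add: K_def matrix_vector_mult_def matrix_matrix_mult_def)
    finally show ?thesis .
  qed
  then have "M = N ** K"
    by (simp add: vec_eq_iff)
  then show thesis
    by (rule that)
qed

text \<open>Appending columns without raising the rank does not enlarge the range; dually, the kernel of
  the transpose does not shrink.\<close>

lemma kernel_of_rank_hblock:
  fixes M :: "real ^ 'p::finite ^ 'q::finite" and N :: "real ^ 'r::finite ^ 'q"
  assumes rank: "rank (hblock M N) = rank N" and v: "transpose N *v v = 0"
  shows "transpose M *v v = 0"
proof -
  have "range ((*v) N) \<subseteq> range ((*v) (hblock M N))"
    using hblock_mult_vcat[of M N 0] by (auto simp: image_iff) (metis)
  moreover have "subspace (range ((*v) N))" "subspace (range ((*v) (hblock M N)))"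
    by (simp_all add: linear_subspace_image)
  ultimately have ranges: "range ((*v) N) = range ((*v) (hblock M N))"
    using rank by (intro subspace_dim_equal) (simp_all add: rank_dim_range)
  have "u \<bullet> (transpose M *v v) = 0" for u
  proof -
    have "M *v u = hblock M N *v vcat u 0"
      by (simp add: hblock_mult_vcat)
    then obtain w where "M *v u = N *v w"
      using ranges by (metis rangeE rangeI)
    then have "u \<bullet> (transpose M *v v) = w \<bullet> (transpose N *v v)"
      by (simp add: inner_transpose_mult del: transpose_matrix_vector)
    then show ?thesis by (simp add: v del: transpose_matrix_vector)
  qed
  then show ?thesis
    by (metis inner_eq_zero_iff)
qed

section \<open>Distance from the line to the cone\<close>

text \<open>If neither alternative held, then \<open>B21 = B22 ** K\<close> with \<open>B22\<close> positive semidefinite, and the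
  square completion
  \<open>2 v \<bullet> (B21 *v u) + v \<bullet> (B22 *v v) = (v + K u) \<bullet> (B22 *v (v + K u)) - K u \<bullet> (B22 *v K u)\<close>
  would show that the perturbation lowers the quadratic form by at most \<open>t\<close> times a constant multiple
  of \<open>(norm u)\<^sup>2\<close>, which the positive diagonal absorbs for small \<open>t\<close>.\<close>

lemma ray_leaves_psd_cone_cases:
  fixes a :: "real ^ 'p::finite" and B11 :: "real ^ 'p ^ 'p"
    and B21 :: "real ^ 'p ^ 'q::finite" and B22 :: "real ^ 'q ^ 'q"
  defines "A \<equiv> diag_matrix (vcat a 0)" and "B \<equiv> block_matrix B11 (transpose B21) B21 B22"
  assumes a: "\<And>k. 0 < a $ k" and symB: "B \<in> sym_mats" and symB22: "B22 \<in> sym_mats"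
    and leaves: "\<And>t. 0 < t \<Longrightarrow> A + t *\<^sub>R B \<notin> psd_cone"
  shows "(\<exists>y. y \<bullet> (B22 *v y) < 0) \<or> (\<exists>v. B22 *v v = 0 \<and> transpose B21 *v v \<noteq> 0)"
proof (rule ccontr)
  assume "\<not> ?thesis"
  then have psd: "\<And>y. 0 \<le> y \<bullet> (B22 *v y)"
    and ker: "\<And>v. B22 *v v = 0 \<Longrightarrow> transpose B21 *v v = 0"
    by (auto simp: not_less)
  have sym: "transpose B22 = B22"
    using symB22 by (simp add: sym_mats_def)
  obtain K where K: "B21 = B22 ** K"
    using factor_through_symmetric[OF sym ker] by blast
  define \<alpha> where "\<alpha> = Min (range (\<lambda>k. a $ k))"
  have \<alpha>: "0 < \<alpha>" "\<And>k. \<alpha> \<le> a $ k"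
    using a by (auto simp: \<alpha>_def)
  define C where "C = norm B11 + norm (transpose K ** (B22 ** K))"
  have "0 \<le> C" by (simp add: C_def)
  define t where "t = \<alpha> / (C + 1)"
  have t: "0 < t" "t * C \<le> \<alpha>"
    using \<alpha>(1) \<open>0 \<le> C\<close> by (auto simp: t_def field_simps)
  have form: "0 \<le> vcat u v \<bullet> ((A + t *\<^sub>R B) *v vcat u v)" for u v
  proof -
    have "\<alpha> * (norm u)\<^sup>2 \<le> u \<bullet> (diag_matrix a *v u)"
    proof -
      have "(norm u)\<^sup>2 = (\<Sum>i\<in>UNIV. (u $ i)\<^sup>2)"
        unfolding power2_norm_eq_inner inner_vec_def by (simp add: power2_eq_square)
      then show ?thesis
        by (simp add: diag_matrix_quadratic_form sum_distrib_left sum_mono mult_right_mono \<alpha>(2))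
    qed
    moreover have "- C * (norm u)\<^sup>2 \<le> u \<bullet> (B11 *v u) + 2 * (v \<bullet> (B21 *v u)) + v \<bullet> (B22 *v v)"
    proof -
      let ?w = "K *v u"
      have cross: "?w \<bullet> (B22 *v v) = v \<bullet> (B22 *v ?w)"
        using inner_transpose_mult[of ?w B22 v] by (simp add: sym)
      have "B21 *v u = B22 *v ?w"
        by (simp add: K matrix_vector_mul_assoc)
      then have "2 * (v \<bullet> (B21 *v u)) + v \<bullet> (B22 *v v)
          = (v + ?w) \<bullet> (B22 *v (v + ?w)) - ?w \<bullet> (B22 *v ?w)"
        by (simp add: matrix_vector_right_distrib inner_add_left inner_add_right cross)
      moreover have "?w \<bullet> (B22 *v ?w) = u \<bullet> ((transpose K ** (B22 ** K)) *v u)"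
        using inner_transpose_mult[of u K "B22 *v ?w"]
        by (simp add: matrix_vector_mul_assoc[symmetric] inner_commute)
      ultimately show ?thesis
        using psd[of "v + ?w"] abs_quadratic_form_le[of u B11]
          abs_quadratic_form_le[of u "transpose K ** (B22 ** K)"]
        by (simp add: C_def algebra_simps)
    qed
    then have "t * (- C * (norm u)\<^sup>2)
        \<le> t * (u \<bullet> (B11 *v u) + 2 * (v \<bullet> (B21 *v u)) + v \<bullet> (B22 *v v))"
      using t(1) by (intro mult_left_mono) auto
    moreover have "t * C * (norm u)\<^sup>2 \<le> \<alpha> * (norm u)\<^sup>2"
      using t(2) by (intro mult_right_mono) auto
    ultimately show ?thesis
      unfolding A_def B_def block_line_quadratic_form by (simp add: algebra_simps)
  qed
  have "A + t *\<^sub>R B \<in> sym_mats"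
    using symB by (auto simp: sym_mats_def A_def diag_matrix_def transpose_def vec_eq_iff)
  moreover have "0 \<le> x \<bullet> ((A + t *\<^sub>R B) *v x)" for x
    using form vcat_components[of x] by metis
  ultimately have "A + t *\<^sub>R B \<in> psd_cone"
    by (simp add: psd_cone_def)
  with leaves[OF t(1)] show False ..
qed

lemma linear_distance_bound:
  fixes a :: "real ^ 'p::finite" and B11 :: "real ^ 'p ^ 'p"
    and B21 :: "real ^ 'p ^ 'q::finite" and B22 :: "real ^ 'q ^ 'q"
  defines "A \<equiv> diag_matrix (vcat a 0)" and "B \<equiv> block_matrix B11 (transpose B21) B21 B22"
  assumes y: "y \<bullet> (B22 *v y) < 0"
  obtains \<kappa> where "0 < \<kappa>"
    and "\<And>t P. P \<in> psd_cone \<Longrightarrow> \<kappa> * t \<le> norm (P - (A + t *\<^sub>R B))"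
proof
  have "y \<noteq> 0" using y by auto
  then show "0 < - (y \<bullet> (B22 *v y)) / (norm y)\<^sup>2"
    using y by (simp add: divide_neg_pos)
  fix t and P :: "real ^ ('p + 'q) ^ ('p + 'q)"
  assume "P \<in> psd_cone"
  then have "t * - (y \<bullet> (B22 *v y)) \<le> norm (P - (A + t *\<^sub>R B)) * (norm y)\<^sup>2"
    using psd_distance_lower_bound[of P "vcat 0 y" "A + t *\<^sub>R B"]
    by (simp add: A_def B_def block_line_quadratic_form norm_vcat)
  then show "- (y \<bullet> (B22 *v y)) / (norm y)\<^sup>2 * t \<le> norm (P - (A + t *\<^sub>R B))"
    using \<open>y \<noteq> 0\<close> by (simp add: field_simps)
qed

text \<open>On the kernel vector \<open>v\<close> the lower right blocks of \<open>A\<close> and \<open>B\<close> both vanish, so the test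
  vector \<open>(- \<epsilon> t w, v)\<close> only has to let the mixed term \<open>- 2 \<epsilon> t\<^sup>2 (norm w)\<^sup>2\<close> beat the terms
  with the factor \<open>\<epsilon>\<^sup>2 t\<^sup>2\<close> that come from the upper left corner.  The bound \<open>T\<close> on \<open>t\<close> allows one
  \<open>\<epsilon>\<close> for the whole segment and keeps the test vectors bounded.\<close>

lemma quadratic_distance_bound:
  fixes a :: "real ^ 'p::finite" and B11 :: "real ^ 'p ^ 'p"
    and B21 :: "real ^ 'p ^ 'q::finite" and B22 :: "real ^ 'q ^ 'q"
  defines "A \<equiv> diag_matrix (vcat a 0)" and "B \<equiv> block_matrix B11 (transpose B21) B21 B22"
  assumes v: "B22 *v v = 0" "transpose B21 *v v \<noteq> 0"
  obtains \<kappa> where "0 < \<kappa>"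
    and "\<And>t P. 0 \<le> t \<Longrightarrow> t \<le> T \<Longrightarrow> P \<in> psd_cone \<Longrightarrow> \<kappa> * t\<^sup>2 \<le> norm (P - (A + t *\<^sub>R B))"
proof
  define w where "w = transpose B21 *v v"
  define C where "C = \<bar>w \<bullet> (diag_matrix a *v w)\<bar> + T * \<bar>w \<bullet> (B11 *v w)\<bar>"
  \<comment> \<open>Small enough that the terms of order \<open>\<epsilon>\<^sup>2\<close> use up at most half of the mixed term
     \<open>2 * \<epsilon> * t\<^sup>2 * (norm w)\<^sup>2\<close>.\<close>
  define \<epsilon> where "\<epsilon> = (norm w)\<^sup>2 / (\<bar>C\<bar> + 1)"
  define X where "X = (\<epsilon> * T)\<^sup>2 * (norm w)\<^sup>2 + (norm v)\<^sup>2"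
  have "w \<noteq> 0" and "v \<noteq> 0" using v by (auto simp: w_def)
  then have \<epsilon>: "0 < \<epsilon>" and X: "0 < X"
    by (auto simp: \<epsilon>_def X_def add_nonneg_pos)
  then show "0 < \<epsilon> * (norm w)\<^sup>2 / X"
    using \<open>w \<noteq> 0\<close> by simp
  fix t and P :: "real ^ ('p + 'q) ^ ('p + 'q)"
  assume t: "0 \<le> t" "t \<le> T" and P: "P \<in> psd_cone"
  let ?x = "vcat (- (\<epsilon> * t) *\<^sub>R w) v"
  have "v \<bullet> (B21 *v w) = (norm w)\<^sup>2"
    using inner_transpose_mult[of w B21 v] by (simp add: w_def power2_norm_eq_inner)
  then have "vcat (s *\<^sub>R w) v \<bullet> ((A + t *\<^sub>R B) *v vcat (s *\<^sub>R w) v)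
      = s\<^sup>2 * (w \<bullet> (diag_matrix a *v w)) + t * (s\<^sup>2 * (w \<bullet> (B11 *v w)) + 2 * s * (norm w)\<^sup>2)" for s
    unfolding A_def B_def block_line_quadratic_form
    by (simp add: v(1) matrix_vector_mult_scaleR power2_eq_square)
  from this[of "- (\<epsilon> * t)"] have form: "?x \<bullet> ((A + t *\<^sub>R B) *v ?x)
      = \<epsilon> * t\<^sup>2 * (\<epsilon> * (w \<bullet> (diag_matrix a *v w) + t * (w \<bullet> (B11 *v w))) - 2 * (norm w)\<^sup>2)"
    by (simp add: power2_eq_square algebra_simps del: scaleR_minus_left)
  have "t * (w \<bullet> (B11 *v w)) \<le> T * \<bar>w \<bullet> (B11 *v w)\<bar>"
    using t by (intro order_trans[OF mult_left_mono[OF abs_ge_self] mult_right_mono]) auto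
  then have "w \<bullet> (diag_matrix a *v w) + t * (w \<bullet> (B11 *v w)) \<le> \<bar>C\<bar>"
    unfolding C_def by linarith
  then have "\<epsilon> * (w \<bullet> (diag_matrix a *v w) + t * (w \<bullet> (B11 *v w))) \<le> \<epsilon> * (\<bar>C\<bar> + 1)"
    using \<epsilon> by (intro mult_left_mono) auto
  also have "\<dots> = (norm w)\<^sup>2"
    by (simp add: \<epsilon>_def)
  finally have "?x \<bullet> ((A + t *\<^sub>R B) *v ?x) \<le> \<epsilon> * t\<^sup>2 * (- (norm w)\<^sup>2)"
    unfolding form using \<epsilon> by (intro mult_left_mono) auto
  then have "\<epsilon> * t\<^sup>2 * (norm w)\<^sup>2 \<le> norm (P - (A + t *\<^sub>R B)) * (norm ?x)\<^sup>2"
    using psd_distance_lower_bound[OF P, of ?x "A + t *\<^sub>R B"] by linarith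
  also have "\<dots> \<le> norm (P - (A + t *\<^sub>R B)) * X"
  proof (rule mult_left_mono)
    have "(\<epsilon> * t)\<^sup>2 \<le> (\<epsilon> * T)\<^sup>2"
      using t \<epsilon> by (intro power_mono mult_left_mono) auto
    then show "(norm ?x)\<^sup>2 \<le> X"
      by (simp add: norm_vcat X_def power_mult_distrib mult_right_mono)
  qed simp
  finally show "\<epsilon> * (norm w)\<^sup>2 / X * t\<^sup>2 \<le> norm (P - (A + t *\<^sub>R B))"
    using X by (simp add: field_simps)
qed

lemma quadratic_distance_bound_of_leaving:
  fixes a :: "real ^ 'p::finite" and B11 :: "real ^ 'p ^ 'p"
    and B21 :: "real ^ 'p ^ 'q::finite" and B22 :: "real ^ 'q ^ 'q"
  defines "A \<equiv> diag_matrix (vcat a 0)" and "B \<equiv> block_matrix B11 (transpose B21) B21 B22"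
  assumes a: "\<And>k. 0 < a $ k" and symB: "B \<in> sym_mats" and symB22: "B22 \<in> sym_mats"
    and leaves: "\<And>t. 0 < t \<Longrightarrow> A + t *\<^sub>R B \<notin> psd_cone"
  obtains \<kappa> where "0 < \<kappa>"
    and "\<And>t P. 0 \<le> t \<Longrightarrow> t \<le> T \<Longrightarrow> P \<in> psd_cone \<Longrightarrow> \<kappa> * t\<^sup>2 \<le> norm (P - (A + t *\<^sub>R B))"
proof -
  consider y where "y \<bullet> (B22 *v y) < 0" | v where "B22 *v v = 0" "transpose B21 *v v \<noteq> 0"
    using ray_leaves_psd_cone_cases[OF a, of B11 B21 B22] symB symB22 leaves
    unfolding A_def B_def by blast
  then show thesis
  proof cases
    case 1
    obtain \<kappa> where \<kappa>: "0 < \<kappa>" "\<And>t P. P \<in> psd_cone \<Longrightarrow> \<kappa> * t \<le> norm (P - (A + t *\<^sub>R B))"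
      using linear_distance_bound[OF 1, of a B11 B21] unfolding A_def B_def by blast
    show thesis
    proof
      \<comment> \<open>On \<open>[0, T]\<close> one has \<open>t\<^sup>2 \<le> \<bar>T\<bar> * t\<close>; the absolute value and the summand 1 only
         keep the denominator positive.\<close>
      show "0 < \<kappa> / (\<bar>T\<bar> + 1)" using \<kappa>(1) by simp
      fix t and P :: "real ^ ('p + 'q) ^ ('p + 'q)"
      assume t: "0 \<le> t" "t \<le> T" and P: "P \<in> psd_cone"
      have "t\<^sup>2 \<le> (\<bar>T\<bar> + 1) * t"
        unfolding power2_eq_square using t by (intro mult_right_mono) auto
      then have "\<kappa> * t\<^sup>2 \<le> \<kappa> * ((\<bar>T\<bar> + 1) * t)"
        using \<kappa>(1) by (intro mult_left_mono) auto
      then have "\<kappa> / (\<bar>T\<bar> + 1) * t\<^sup>2 \<le> \<kappa> * t"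
        by (simp add: field_simps)
      with \<kappa>(2)[OF P, of t] show "\<kappa> / (\<bar>T\<bar> + 1) * t\<^sup>2 \<le> norm (P - (A + t *\<^sub>R B))"
        by linarith
    qed
  next
    case 2
    then show thesis
      using quadratic_distance_bound[OF 2, of T a B11] that unfolding A_def B_def by blast
  qed
qed

lemma uminus_block_matrix:
  "- block_matrix M11 M12 M21 M22 = block_matrix (- M11) (- M12) (- M21) (- M22)"
  for M11 :: "real ^ 'p::finite ^ 'p"
  by (simp add: block_matrix_def hblock_def vcat_def vec_eq_iff split: sum.split)

lemma transpose_uminus: "transpose (- M) = - transpose M" for M :: "real ^ 'p ^ 'q"
  by (simp add: transpose_def vec_eq_iff)

lemma uminus_mult_vec: "(- M) *v x = - (M *v x)" for M :: "real ^ 'p ^ 'q"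
  by (simp add: matrix_vector_mult_def vec_eq_iff sum_negf)

lemma uminus_sym_mats: "M \<in> sym_mats \<Longrightarrow> - M \<in> sym_mats"
  by (simp add: sym_mats_def transpose_uminus)

section \<open>Rate of convergence\<close>

theorem theorem5p3:
  fixes a :: "real ^ ('p::finite)"
    and A B :: "real ^ ('p + 'q::finite) ^ ('p + 'q)"
    and B11 :: "real ^ 'p ^ 'p"
    and B21 :: "real ^ 'p ^ 'q"
    and B22 :: "real ^ 'q ^ 'q"
    and E :: "(real ^ ('p + 'q) ^ ('p + 'q)) set"
    and U :: "nat \<Rightarrow> real ^ ('p + 'q) ^ ('p + 'q)"
  assumes "\<And>k. 0 < a $ k"
    and "A = diag_matrix (vcat a 0)"
    and "B \<in> sym_mats"
    and "B11 \<in> sym_mats"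
    and "B22 \<in> sym_mats"
    and "B = block_matrix B11 (transpose B21) B21 B22"
    and "B \<noteq> 0"
    and "E = matrix_line A B"
    and "psd_cone \<inter> E = {A}"
    and "U 0 \<in> E"
    and "\<And>k. U (Suc k) = closest_point E (closest_point psd_cone (U k))"
  shows "(\<lambda>k. norm (U k - A)) \<in> O(\<lambda>k. real k powr (- 1 / 2)) \<and>
         (rank (hblock B21 B22) = rank B22 \<longrightarrow>
          (\<exists>c q. 0 < c \<and> 0 < q \<and> q < 1 \<and> (\<forall>k. norm (U k - A) \<le> c * q ^ k)))"
proof -
  note pos = assms(1) and A = assms(2) and symB = assms(3) and symB22 = assms(5) and B = assms(6)
    and E = assms(8) and meet = assms(9)
  have "affine E"
    unfolding E matrix_line_def affine_def
  proof clarify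
    fix r s t t' :: real assume rs: "r + s = 1"
    have "r *\<^sub>R (A + t *\<^sub>R B) + s *\<^sub>R (A + t' *\<^sub>R B) = (r + s) *\<^sub>R A + (r * t + s * t') *\<^sub>R B"
      by (simp add: algebra_simps)
    then show "\<exists>t''. r *\<^sub>R (A + t *\<^sub>R B) + s *\<^sub>R (A + t' *\<^sub>R B) = A + t'' *\<^sub>R B \<and> True"
      by (auto simp: rs)
  qed
  then have sets: "convex psd_cone" "closed (psd_cone :: (real ^ ('p + 'q) ^ ('p + 'q)) set)"
      "convex E" "closed E" "A \<in> psd_cone" "A \<in> E"
    using convex_psd_cone closed_psd_cone affine_imp_convex affine_closed meet by auto
  have negB: "- B = block_matrix (- B11) (transpose (- B21)) (- B21) (- B22)"
    by (simp add: B uminus_block_matrix transpose_uminus)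
  have leaves: "A + t *\<^sub>R B \<notin> psd_cone" if "t \<noteq> 0" for t
  proof
    assume "A + t *\<^sub>R B \<in> psd_cone"
    moreover have "A + t *\<^sub>R B \<in> E"
      by (auto simp: E matrix_line_def)
    ultimately have "A + t *\<^sub>R B = A"
      using meet by blast
    with that \<open>B \<noteq> 0\<close> show False by simp
  qed
  have leaves_pos: "A + t *\<^sub>R B \<notin> psd_cone" if "0 < t" for t
    using leaves[of t] that by simp
  have leaves_neg: "A + t *\<^sub>R - B \<notin> psd_cone" if "0 < t" for t
    using leaves[of "- t"] that by simp
  have nB: "0 < norm B" using \<open>B \<noteq> 0\<close> by simp
  have "(\<lambda>k. dist (U k) A) \<in> O(\<lambda>k. real k powr (- 1 / 2))"
  proof -
    define T where "T = dist (U 0) A / norm B"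
    obtain \<kappa>1 where \<kappa>1: "0 < \<kappa>1"
      "\<And>t P. 0 \<le> t \<Longrightarrow> t \<le> T \<Longrightarrow> P \<in> psd_cone \<Longrightarrow> \<kappa>1 * t\<^sup>2 \<le> norm (P - (A + t *\<^sub>R B))"
      using quadratic_distance_bound_of_leaving[of a B11 B21 B22 T, folded A B,
          OF pos symB symB22 leaves_pos] by blast
    obtain \<kappa>2 where \<kappa>2: "0 < \<kappa>2"
      "\<And>t P. 0 \<le> t \<Longrightarrow> t \<le> T \<Longrightarrow> P \<in> psd_cone \<Longrightarrow> \<kappa>2 * t\<^sup>2 \<le> norm (P - (A + t *\<^sub>R - B))"
      using quadratic_distance_bound_of_leaving[of a "- B11" "- B21" "- B22" T, folded A negB,
          OF pos uminus_sym_mats[OF symB] uminus_sym_mats[OF symB22] leaves_neg] by blast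
    define \<kappa> where "\<kappa> = min \<kappa>1 \<kappa>2"
    have both: "\<kappa> * t\<^sup>2 \<le> norm (P - (A + t *\<^sub>R B))" if "\<bar>t\<bar> \<le> T" "P \<in> psd_cone" for t P
    proof (cases "0 \<le> t")
      case True
      have "\<kappa> * t\<^sup>2 \<le> \<kappa>1 * t\<^sup>2" by (intro mult_right_mono) (auto simp: \<kappa>_def)
      also have "\<dots> \<le> norm (P - (A + t *\<^sub>R B))" using \<kappa>1(2)[of t P] True that by simp
      finally show ?thesis .
    next
      case False
      have "\<kappa> * t\<^sup>2 \<le> \<kappa>2 * t\<^sup>2" by (intro mult_right_mono) (auto simp: \<kappa>_def)
      also have "\<dots> \<le> norm (P - (A + t *\<^sub>R B))" using \<kappa>2(2)[of "- t" P] False that by simp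
      finally show ?thesis .
    qed
    show ?thesis
    proof (rule alternating_projections_quadratic_bound[OF sets])
      show "U 0 \<in> E" by fact
      show "U (Suc k) = closest_point E (closest_point psd_cone (U k))" for k by fact
      show "0 < \<kappa> / (norm B)\<^sup>2" using \<kappa>1(1) \<kappa>2(1) nB by (simp add: \<kappa>_def)
      fix V P :: "real ^ ('p + 'q) ^ ('p + 'q)"
      assume "V \<in> E" and V: "dist V A \<le> dist (U 0) A" and P: "P \<in> psd_cone"
      then obtain t where t: "V = A + t *\<^sub>R B" by (auto simp: E matrix_line_def)
      have dist: "dist V A = \<bar>t\<bar> * norm B" by (simp add: t dist_norm)
      then have "\<bar>t\<bar> \<le> T" using V nB by (simp add: T_def field_simps)
      then have "\<kappa> * t\<^sup>2 \<le> dist V P"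
        using both[of t P] P by (simp add: t dist_norm norm_minus_commute)
      then show "\<kappa> / (norm B)\<^sup>2 * (dist V A)\<^sup>2 \<le> dist V P"
        using nB by (simp add: dist power_mult_distrib)
    qed
  qed
  moreover have "\<exists>c q. 0 < c \<and> 0 < q \<and> q < 1 \<and> (\<forall>k. dist (U k) A \<le> c * q ^ k)"
    if rank: "rank (hblock B21 B22) = rank B22"
  proof -
    have ker: "transpose B21 *v v = 0" if "B22 *v v = 0" for v
      using kernel_of_rank_hblock[OF rank, of v] that symB22
      by (simp add: sym_mats_def del: transpose_matrix_vector)
    obtain y where y: "y \<bullet> (B22 *v y) < 0"
      using ray_leaves_psd_cone_cases[of a B11 B21 B22, folded A B, OF pos symB symB22 leaves_pos] ker
      by blast
    obtain z where z: "z \<bullet> ((- B22) *v z) < 0"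
      using ray_leaves_psd_cone_cases[of a "- B11" "- B21" "- B22", folded A negB,
          OF pos uminus_sym_mats[OF symB] uminus_sym_mats[OF symB22] leaves_neg] ker
      unfolding transpose_uminus uminus_mult_vec neg_equal_0_iff_equal by blast
    obtain \<kappa>1 where \<kappa>1: "0 < \<kappa>1"
      "\<And>t P. P \<in> psd_cone \<Longrightarrow> \<kappa>1 * t \<le> norm (P - (A + t *\<^sub>R B))"
      using linear_distance_bound[OF y, of a B11 B21, folded A B] by blast
    obtain \<kappa>2 where \<kappa>2: "0 < \<kappa>2"
      "\<And>t P. P \<in> psd_cone \<Longrightarrow> \<kappa>2 * t \<le> norm (P - (A + t *\<^sub>R - B))"
      using linear_distance_bound[OF z, of a "- B11" "- B21", folded A negB] by blast
    define \<kappa> where "\<kappa> = min \<kappa>1 \<kappa>2"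
    have both: "\<kappa> * \<bar>t\<bar> \<le> norm (P - (A + t *\<^sub>R B))" if "P \<in> psd_cone" for t P
    proof (cases "0 \<le> t")
      case True
      have "\<kappa> * \<bar>t\<bar> \<le> \<kappa>1 * \<bar>t\<bar>" by (intro mult_right_mono) (auto simp: \<kappa>_def)
      also have "\<dots> \<le> norm (P - (A + t *\<^sub>R B))" using \<kappa>1(2)[OF that, of t] True by simp
      finally show ?thesis .
    next
      case False
      have "\<kappa> * \<bar>t\<bar> \<le> \<kappa>2 * \<bar>t\<bar>" by (intro mult_right_mono) (auto simp: \<kappa>_def)
      also have "\<dots> \<le> norm (P - (A + t *\<^sub>R B))" using \<kappa>2(2)[OF that, of "- t"] False by simp
      finally show ?thesis .
    qed
    show ?thesis
    proof (rule alternating_projections_linear_bound[OF sets])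
      show "U 0 \<in> E" by fact
      show "U (Suc k) = closest_point E (closest_point psd_cone (U k))" for k by fact
      show "0 < \<kappa> / norm B" using \<kappa>1(1) \<kappa>2(1) nB by (simp add: \<kappa>_def)
      fix V P :: "real ^ ('p + 'q) ^ ('p + 'q)"
      assume "V \<in> E" and P: "P \<in> psd_cone"
      then obtain t where t: "V = A + t *\<^sub>R B" by (auto simp: E matrix_line_def)
      have "dist V A = \<bar>t\<bar> * norm B" by (simp add: t dist_norm)
      then show "\<kappa> / norm B * dist V A \<le> dist V P"
        using both[OF P, of t] nB by (simp add: t dist_norm norm_minus_commute)
    qed
  qed
  ultimately show ?thesis
    by (simp add: dist_norm)
qed

end
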